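(* Let $k,m,n$ be integers with $3\leq k\leq mn$ and $n\leq m$, and let $G,H$ be connected graphs of orders $n,m$ respectively. (1) If $k\leq n$, then $sdiam_k(G)+sdiam_k(H)\leq sdiam_k(G\Box H)\leq sdiam_k(G)+sdiam_k(H)+(k-3)\min\{sdiam_k(G),sdiam_k(H)\}$. (2) If $n<k\leq m$, then $n-1+sdiam_k(H)\leq sdiam_k(G\Box H)\leq n-1+sdiam_k(H)+(k-3)\min\{n-1,sdiam_k(H)\}$. (3) If $m<k\leq mn$, then $n+m-2\leq sdiam_k(G\Box H)\leq m-1+(k-2)(n-1)$. (4) If $mn-\kappa(G\Box H)+1\leq k\leq mn$, then $sdiam_k(G\Box H)=k-1$.
   Context: For a connected graph $F$ and $S\subseteq V(F)$ with $|S|\ge 2$, the Steiner distance $d_F(S)$ is the minimum number of edges of a connected subgraph of $F$ whose vertex set contains $S$. For $2\le k\le |V(F)|$, the Steiner $k$-diameter is $sdiam_k(F)=\max\{d_F(S): S\subseteq V(F),\ |S|=k\}$. $\kappa(F)$ denotes the vertex connectivity of $F$. The Cartesian product $G\Box H$ has vertex set $V(G)\times V(H)$, with $(g,h)\sim(g',h')$ iff either $g=g'$ and $hh'\in E(H)$, or $h=h'$ and $gg'\in E(G)$. *)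

theory Defs
  imports Main
begin

record 'a ugraph =
  verts :: "'a set"
  edges :: "'a set set"

definition simple_graph :: "'a ugraph \<Rightarrow> bool" where
  "simple_graph F \<longleftrightarrow> finite (verts F) \<and>
     edges F \<subseteq> {{u, v} |u v. u \<in> verts F \<and> v \<in> verts F \<and> u \<noteq> v}"

definition subgraph :: "'a ugraph \<Rightarrow> 'a ugraph \<Rightarrow> bool" where
  "subgraph T F \<longleftrightarrow> simple_graph T \<and> verts T \<subseteq> verts F \<and> edges T \<subseteq> edges F"

(* The empty graph does not count as connected. *)
definition connected_graph :: "'a ugraph \<Rightarrow> bool" where
  "connected_graph F \<longleftrightarrow> verts F \<noteq> {} \<and>
     (\<forall>u \<in> verts F. \<forall>v \<in> verts F. (u, v) \<in> {(x, y). {x, y} \<in> edges F}\<^sup>*)"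

(* Inf on nat is an attained minimum whenever the set is nonempty, which is the case
   if F is connected and S \<subseteq> verts F. *)
definition steiner_distance :: "'a ugraph \<Rightarrow> 'a set \<Rightarrow> nat" where
  "steiner_distance F S =
     Inf {card (edges T) |T. subgraph T F \<and> connected_graph T \<and> S \<subseteq> verts T}"

definition sdiam :: "nat \<Rightarrow> 'a ugraph \<Rightarrow> nat" where
  "sdiam k F = Max {steiner_distance F S |S. S \<subseteq> verts F \<and> card S = k}"

definition delete_verts :: "'a ugraph \<Rightarrow> 'a set \<Rightarrow> 'a ugraph" where
  "delete_verts F X = \<lparr>verts = verts F - X, edges = {e \<in> edges F. e \<inter> X = {}}\<rparr>"

(* Standard convention covering complete graphs: the least number of vertices whose
   deletion leaves a disconnected graph or a single vertex. *)
definition vertex_connectivity :: "'a ugraph \<Rightarrow> nat" ("\<kappa>") where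
  "\<kappa> F = Inf {card X |X. X \<subseteq> verts F \<and>
     (\<not> connected_graph (delete_verts F X) \<or> card (verts (delete_verts F X)) = 1)}"

definition cartesian_product :: "'a ugraph \<Rightarrow> 'b ugraph \<Rightarrow> ('a \<times> 'b) ugraph"
  (infixl "\<box>" 70) where
  "G \<box> H = \<lparr>verts = verts G \<times> verts H,
     edges = {{(g, h), (g', h')} |g h g' h'.
       g \<in> verts G \<and> g' \<in> verts G \<and> h \<in> verts H \<and> h' \<in> verts H \<and>
       (g = g' \<and> {h, h'} \<in> edges H \<or> h = h' \<and> {g, g'} \<in> edges G)}\<rparr>"

lemma vertex_connectivity_less_order:
  assumes "finite (verts F)" "verts F \<noteq> {}"
  shows "\<kappa> F < card (verts F)"
proof -
  obtain v where v: "v \<in> verts F" using assms(2) by blast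
  have "verts F - (verts F - {v}) = {v}" using v by blast
  then have "\<kappa> F \<le> card (verts F - {v})"
    unfolding vertex_connectivity_def
    by (intro cInf_lower CollectI exI[of _ "verts F - {v}"]) (auto simp: delete_verts_def)
  also have "\<dots> < card (verts F)"
    using v assms(1) by (rule card_Diff1_less[rotated])
  finally show ?thesis .
qed

end

theory Submission
  imports Defs
begin

text \<open>
  A connected vertex set \<open>W\<close> has a spanning tree with \<open>|W| - 1\<close> edges, so Steiner distances can be
  read off from the sizes of connected vertex sets. For the lower bounds, the edges of a connected
  subgraph of \<open>G \<box> H\<close> split into \<open>G\<close>-edges and \<open>H\<close>-edges, and each class projects onto a connected
  subgraph of its factor; the terminals are chosen so that both projections are extremal.
  For the upper bounds, let \<open>W\<^sub>G\<close>, \<open>W\<^sub>H\<close> be connected sets containing the two projections of the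
  terminals. Three terminals have a median \<open>x\<close> in \<open>W\<^sub>G\<close>: connecting \<open>x\<close> to their projections costs
  at most \<open>|W\<^sub>G| - 1\<close> edges altogether. Take the copy of \<open>W\<^sub>H\<close> over \<open>x\<close>, the three connections to
  the median, and one copy of \<open>W\<^sub>G\<close> for each of the other \<open>k - 3\<close> terminals.
  If fewer than \<open>\<kappa>\<close> vertices are not terminals, the terminals alone form a connected set.
\<close>

section \<open>Connected vertex sets and spanning trees\<close>

text \<open>Connectedness is encoded as growth by one vertex and one edge at a time. This makes the
  sets finite and nonempty, and its induction rule produces both the spanning tree and the
  median.\<close>

inductive connected_set :: "'a set set \<Rightarrow> 'a set \<Rightarrow> bool" for E where
  singleton: "connected_set E {v}"
| insert: "connected_set E W \<Longrightarrow> u \<in> W \<Longrightarrow> v \<notin> W \<Longrightarrow> {u, v} \<in> E \<Longrightarrow> connected_set E (insert v W)"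

lemma connected_set_finite: "connected_set E W \<Longrightarrow> finite W"
  by (induction rule: connected_set.induct) auto

lemma connected_set_nonempty: "connected_set E W \<Longrightarrow> W \<noteq> {}"
  by (induction rule: connected_set.induct) auto

lemma connected_set_image:
  assumes "connected_set E W" "inj_on f W"
    and "\<And>u v. u \<in> W \<Longrightarrow> v \<in> W \<Longrightarrow> {u, v} \<in> E \<Longrightarrow> {f u, f v} \<in> E'"
  shows "connected_set E' (f ` W)"
  using assms
proof (induction rule: connected_set.induct)
  case (singleton v)
  show ?case by (auto intro: connected_set.singleton)
next
  case (insert W u v)
  have "connected_set E' (f ` W)"
    using insert.IH insert.prems by (auto intro: inj_on_subset)
  moreover have "f v \<notin> f ` W" using insert.prems(1) insert.hyps(3) by auto
  moreover have "{f u, f v} \<in> E'" using insert.prems(2) insert.hyps by auto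
  ultimately show ?case using insert.hyps(2) by (auto intro: connected_set.insert)
qed

lemma connected_set_mono: "connected_set E W \<Longrightarrow> E \<subseteq> E' \<Longrightarrow> connected_set E' W"
  using connected_set_image[of E W id E'] by auto

lemma rtrancl_leaves_set:
  assumes "(u, v) \<in> R\<^sup>*" "u \<in> A" "v \<notin> A"
  obtains x y where "x \<in> A" "y \<notin> A" "(x, y) \<in> R"
proof -
  have "\<exists>x y. x \<in> A \<and> y \<notin> A \<and> (x, y) \<in> R"
    using assms by (induction rule: rtrancl_induct) auto
  then show ?thesis using that by blast
qed

text \<open>Take a maximal connected subset of the vertices. If it missed a vertex, a walk to that
  vertex would cross an edge leaving the subset, and the far end could be added. Edges are only
  asked to lie inside the vertex set, so the lemma applies directly to unions of graphs and to
  vertex-deleted graphs.\<close>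

lemma connected_graph_imp_connected_set:
  assumes fin: "finite (verts F)" and sub: "\<And>e. e \<in> edges F \<Longrightarrow> e \<subseteq> verts F"
    and con: "connected_graph F"
  shows "connected_set (edges F) (verts F)"
proof -
  define C where "C = {A. A \<subseteq> verts F \<and> connected_set (edges F) A}"
  obtain w where "w \<in> verts F" using con by (auto simp: connected_graph_def)
  then have "C \<noteq> {}" by (auto simp: C_def intro: connected_set.singleton)
  moreover have "finite C" using fin by (simp add: C_def)
  ultimately obtain A where "A \<in> C" and max: "\<forall>B \<in> C. A \<subseteq> B \<longrightarrow> A = B"
    using finite_has_maximal[of C] by blast
  then have A: "A \<subseteq> verts F" "connected_set (edges F) A" by (auto simp: C_def)
  have "verts F \<subseteq> A"
  proof
    fix v assume v: "v \<in> verts F"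
    show "v \<in> A"
    proof (rule ccontr)
      assume nv: "v \<notin> A"
      obtain u where u: "u \<in> A" using A connected_set_nonempty by blast
      then have "(u, v) \<in> {(x, y). {x, y} \<in> edges F}\<^sup>*"
        using con v A by (auto simp: connected_graph_def)
      then obtain x y where xy: "x \<in> A" "y \<notin> A" "{x, y} \<in> edges F"
        using u nv by (auto elim: rtrancl_leaves_set)
      then have "insert y A \<in> C"
        using A sub[OF xy(3)] by (auto simp: C_def intro: connected_set.insert)
      then have "A = insert y A" using max by (meson subset_insertI)
      then show False using xy(2) by blast
    qed
  qed
  then have "A = verts F" using A by blast
  then show ?thesis using A by simp
qed

lemma simple_graph_edge_subset: "simple_graph F \<Longrightarrow> e \<in> edges F \<Longrightarrow> e \<subseteq> verts F"
  unfolding simple_graph_def by blast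

lemma simple_connected_imp_connected_set:
  assumes "simple_graph F" "connected_graph F"
  shows "connected_set (edges F) (verts F)"
  using assms simple_graph_edge_subset
  by (intro connected_graph_imp_connected_set) (auto simp: simple_graph_def)

lemma connected_graph_insert:
  assumes con: "connected_graph T" and u: "u \<in> verts T"
  shows "connected_graph \<lparr>verts = insert v (verts T), edges = insert {u, v} (edges T)\<rparr>"
proof -
  let ?R = "{(x, y). {x, y} \<in> insert {u, v} (edges T)}"
  have "{(x, y). {x, y} \<in> edges T}\<^sup>* \<subseteq> ?R\<^sup>*" by (rule rtrancl_mono) auto
  then have old: "(x, y) \<in> ?R\<^sup>*" if "x \<in> verts T" "y \<in> verts T" for x y
    using con that unfolding connected_graph_def by blast
  have uv: "(u, v) \<in> ?R\<^sup>*" "(v, u) \<in> ?R\<^sup>*" by (auto simp: insert_commute)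
  have toU: "(x, u) \<in> ?R\<^sup>* \<and> (u, x) \<in> ?R\<^sup>*" if "x \<in> insert v (verts T)" for x
    using that uv old u by blast
  have "(x, y) \<in> ?R\<^sup>*" if "x \<in> insert v (verts T)" "y \<in> insert v (verts T)" for x y
    using rtrancl_trans[OF conjunct1[OF toU[OF that(1)]] conjunct2[OF toU[OF that(2)]]] .
  then show ?thesis unfolding connected_graph_def by simp
qed

text \<open>Each growth step adds one vertex and one edge; the edge is new because all earlier edges
  lie inside the old set. This is the bridge from counting vertices to counting edges.\<close>

lemma connected_set_spanning_tree:
  assumes "connected_set E W"
  obtains T where "verts T = W" "edges T \<subseteq> E" "simple_graph T" "connected_graph T"
    "card W = Suc (card (edges T))"
proof -
  have "\<exists>T. verts T = W \<and> edges T \<subseteq> E \<and> simple_graph T \<and> connected_graph T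
    \<and> card W = Suc (card (edges T))"
    using assms
  proof (induction rule: connected_set.induct)
    case (singleton v)
    show ?case
      by (rule exI[of _ "\<lparr>verts = {v}, edges = {}\<rparr>"])
        (auto simp: simple_graph_def connected_graph_def)
  next
    case (insert W u v)
    then obtain T where T: "verts T = W" "edges T \<subseteq> E" "simple_graph T" "connected_graph T"
      "card W = Suc (card (edges T))" by blast
    let ?T = "\<lparr>verts = insert v (verts T), edges = insert {u, v} (edges T)\<rparr>"
    have fW: "finite W" using insert.hyps(1) by (rule connected_set_finite)
    have sub: "edges T \<subseteq> Pow W" using T(1) simple_graph_edge_subset[OF T(3)] by blast
    then have "finite (edges T)" using fW finite_subset by blast
    moreover have "{u, v} \<notin> edges T" using sub insert.hyps(3) by blast
    ultimately have "card (insert v W) = Suc (card (edges ?T))"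
      using fW insert.hyps(3) T(5) by simp
    moreover have "simple_graph ?T"
      using T(1,3) insert.hyps unfolding simple_graph_def by fastforce
    moreover have "connected_graph ?T"
      using T(1,4) insert.hyps(2) by (intro connected_graph_insert) auto
    ultimately show ?case using T insert.hyps(4) by (intro exI[of _ ?T]) auto
  qed
  then show ?thesis using that by blast
qed

text \<open>The growth orders of the two sets do not combine directly. The proof passes to the union
  of two spanning trees, where any two vertices are joined through \<open>x\<close>, and then back
  to a connected set.\<close>

lemma connected_set_Un:
  assumes A: "connected_set E A" and B: "connected_set E B" and x: "x \<in> A" "x \<in> B"
  shows "connected_set E (A \<union> B)"
proof -
  obtain S where S: "verts S = A" "edges S \<subseteq> E" "simple_graph S" "connected_graph S"
    using A by (rule connected_set_spanning_tree)
  obtain T where T: "verts T = B" "edges T \<subseteq> E" "simple_graph T" "connected_graph T"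
    using B by (rule connected_set_spanning_tree)
  let ?F = "\<lparr>verts = A \<union> B, edges = edges S \<union> edges T\<rparr>"
  let ?R = "{(x, y). {x, y} \<in> edges S \<union> edges T}"
  have "{(x, y). {x, y} \<in> edges S}\<^sup>* \<subseteq> ?R\<^sup>*" "{(x, y). {x, y} \<in> edges T}\<^sup>* \<subseteq> ?R\<^sup>*"
    by (rule rtrancl_mono; auto)+
  then have toX: "(y, x) \<in> ?R\<^sup>* \<and> (x, y) \<in> ?R\<^sup>*" if "y \<in> A \<union> B" for y
    using S(1,4) T(1,4) x that unfolding connected_graph_def by blast
  have "(y, z) \<in> ?R\<^sup>*" if "y \<in> A \<union> B" "z \<in> A \<union> B" for y z
    using rtrancl_trans[OF conjunct1[OF toX[OF that(1)]] conjunct2[OF toX[OF that(2)]]] .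
  then have "connected_graph ?F" using x by (auto simp: connected_graph_def)
  then have "connected_set (edges ?F) (verts ?F)"
    using simple_graph_edge_subset[OF S(3)] simple_graph_edge_subset[OF T(3)] S(1) T(1)
      connected_set_finite[OF A] connected_set_finite[OF B]
    by (intro connected_graph_imp_connected_set) auto
  then show ?thesis using S(2) T(2) by (auto intro: connected_set_mono)
qed

section \<open>Medians of three vertices\<close>

definition spoke :: "'a set set \<Rightarrow> 'a set \<Rightarrow> 'a \<Rightarrow> 'a \<Rightarrow> 'a set \<Rightarrow> bool" where
  "spoke E W x a P \<longleftrightarrow> connected_set E P \<and> P \<subseteq> W \<and> x \<in> P \<and> a \<in> P"

text \<open>In a tree the paths from the median to three vertices meet only in the median, which is
  thus counted three times: this is the \<open>+ 2\<close>. The induction adds a leaf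
  \<open>v\<close>: if exactly one of the three vertices is \<open>v\<close>, the neighbour
  \<open>u\<close> replaces it and its spoke is then extended by \<open>v\<close>, which raises both
  sides by one.\<close>

lemma connected_set_median:
  assumes "connected_set E W" "a \<in> W" "b \<in> W" "c \<in> W"
  shows "\<exists>x A B C. spoke E W x a A \<and> spoke E W x b B \<and> spoke E W x c C
    \<and> card A + card B + card C \<le> card W + 2"
  using assms
proof (induction arbitrary: a b c rule: connected_set.induct)
  case (singleton v)
  then have "spoke E {v} v a {v}" "a = v" "b = v" "c = v"
    by (auto simp: spoke_def intro: connected_set.singleton)
  then show ?case
    by (intro exI[of _ v] exI[of _ "{v}"]) simp
next
  case (insert W u v)
  let ?V = "insert v W"
  have V: "connected_set E ?V" using insert.hyps by (rule connected_set.insert)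
  have cV: "card ?V = Suc (card W)"
    using connected_set_finite[OF insert.hyps(1)] insert.hyps(3) by simp
  have triv: "spoke E ?V v v {v}" by (simp add: spoke_def connected_set.singleton)
  have old: "spoke E ?V x y D" if "spoke E W x y D" for x y D
    using that by (auto simp: spoke_def)
  have new: "spoke E ?V x v (insert v D) \<and> card (insert v D) = Suc (card D)"
    if "spoke E W x u D" for x D
  proof -
    have D: "connected_set E D" "D \<subseteq> W" "x \<in> D" "u \<in> D" "v \<notin> D"
      using that insert.hyps(3) by (auto simp: spoke_def)
    then have "connected_set E (insert v D)" using insert.hyps(4) by (intro connected_set.insert)
    then show ?thesis using D connected_set_finite[OF D(1)] by (auto simp: spoke_def)
  qed
  \<comment> \<open>At least two of the three vertices are \<open>v\<close> (cases 1 to 3), exactly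
    one is (4 to 6), or none is (7).\<close>
  consider "a = v" "b = v" | "a = v" "c = v" | "b = v" "c = v"
    | "a = v" "b \<in> W" "c \<in> W" | "b = v" "a \<in> W" "c \<in> W" | "c = v" "a \<in> W" "b \<in> W"
    | "a \<in> W" "b \<in> W" "c \<in> W"
    using insert.prems by blast
  then show ?case
  proof cases
    case 1
    \<comment> \<open>With hub \<open>v\<close> the two coinciding vertices have spokes of size one,
      so the third spoke may be the entire set and the bound is met with equality.\<close>
    then have "spoke E ?V v c ?V" using V insert.prems by (simp add: spoke_def)
    then show ?thesis using triv 1 cV
      by (intro exI[of _ v] exI[of _ "{v}"] exI[of _ "{v}"] exI[of _ ?V]) simp
  next
    case 2
    then have "spoke E ?V v b ?V" using V insert.prems by (simp add: spoke_def)
    then show ?thesis using triv 2 cV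
      by (intro exI[of _ v] exI[of _ "{v}"] exI[of _ ?V] exI[of _ "{v}"]) simp
  next
    case 3
    then have "spoke E ?V v a ?V" using V insert.prems by (simp add: spoke_def)
    then show ?thesis using triv 3 cV
      by (intro exI[of _ v] exI[of _ ?V] exI[of _ "{v}"] exI[of _ "{v}"]) simp
  next
    case 4
    obtain x A B C where *: "spoke E W x u A" "spoke E W x b B" "spoke E W x c C"
      "card A + card B + card C \<le> card W + 2"
      using insert.IH[OF insert.hyps(2) 4(2,3)] by blast
    show ?thesis
      using * old[OF *(1)] old[OF *(2)] old[OF *(3)] new[OF *(1)] 4 cV
      by (intro exI[of _ x] exI[of _ "insert v A"] exI[of _ B] exI[of _ C]) simp
  next
    case 5
    obtain x A B C where *: "spoke E W x a A" "spoke E W x u B" "spoke E W x c C"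
      "card A + card B + card C \<le> card W + 2"
      using insert.IH[OF 5(2) insert.hyps(2) 5(3)] by blast
    show ?thesis
      using * old[OF *(1)] old[OF *(2)] old[OF *(3)] new[OF *(2)] 5 cV
      by (intro exI[of _ x] exI[of _ A] exI[of _ "insert v B"] exI[of _ C]) simp
  next
    case 6
    obtain x A B C where *: "spoke E W x a A" "spoke E W x b B" "spoke E W x u C"
      "card A + card B + card C \<le> card W + 2"
      using insert.IH[OF 6(2,3) insert.hyps(2)] by blast
    show ?thesis
      using * old[OF *(1)] old[OF *(2)] old[OF *(3)] new[OF *(3)] 6 cV
      by (intro exI[of _ x] exI[of _ A] exI[of _ B] exI[of _ "insert v C"]) simp
  next
    case 7
    obtain x A B C where *: "spoke E W x a A" "spoke E W x b B" "spoke E W x c C"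
      "card A + card B + card C \<le> card W + 2"
      using insert.IH[OF 7] by blast
    show ?thesis
      using * old[OF *(1)] old[OF *(2)] old[OF *(3)] 7 cV
      by (intro exI[of _ x] exI[of _ A] exI[of _ B] exI[of _ C]) simp
  qed
qed

section \<open>Steiner distance and Steiner diameter via connected sets\<close>

lemma steiner_distance_le:
  assumes "subgraph T F" "connected_graph T" "S \<subseteq> verts T"
  shows "steiner_distance F S \<le> card (edges T)"
  unfolding steiner_distance_def using assms by (intro cInf_lower) auto

lemma steiner_distance_le_connected_set:
  assumes "connected_set (edges F) W" "S \<subseteq> W" "W \<subseteq> verts F"
  shows "steiner_distance F S \<le> card W - 1"
proof -
  obtain T where "verts T = W" "edges T \<subseteq> edges F" "simple_graph T" "connected_graph T"
    "card W = Suc (card (edges T))"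
    using assms(1) by (rule connected_set_spanning_tree)
  then show ?thesis using steiner_distance_le[of T F S] assms by (auto simp: subgraph_def)
qed

lemma steiner_distance_attained:
  assumes "simple_graph F" "connected_graph F" "S \<subseteq> verts F"
  obtains T where "subgraph T F" "connected_graph T" "S \<subseteq> verts T"
    "card (edges T) = steiner_distance F S"
proof -
  let ?D = "{card (edges T) |T. subgraph T F \<and> connected_graph T \<and> S \<subseteq> verts T}"
  \<comment> \<open>\<open>F\<close> itself is a candidate, so the infimum is attained.\<close>
  have "?D \<noteq> {}" using assms by (auto simp: subgraph_def)
  then have "steiner_distance F S \<in> ?D"
    unfolding steiner_distance_def by (rule Inf_nat_def1)
  then show ?thesis using that by auto
qed

lemma simple_graph_finite_edges:
  assumes "simple_graph F"
  shows "finite (edges F)"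
proof -
  have "edges F \<subseteq> Pow (verts F)" using simple_graph_edge_subset[OF assms] by blast
  then show ?thesis using assms finite_subset by (auto simp: simple_graph_def)
qed

lemma card_verts_le_Suc_card_edges:
  assumes "simple_graph T" "connected_graph T"
  shows "card (verts T) \<le> Suc (card (edges T))"
proof -
  obtain T' where "verts T' = verts T" "edges T' \<subseteq> edges T" "simple_graph T'" "connected_graph T'"
    "card (verts T) = Suc (card (edges T'))"
    using simple_connected_imp_connected_set[OF assms] by (rule connected_set_spanning_tree)
  then show ?thesis using simple_graph_finite_edges[OF assms(1)] by (simp add: card_mono)
qed

lemma steiner_distance_connected_set:
  assumes "simple_graph F" "connected_graph F" "S \<subseteq> verts F"
  obtains W where "connected_set (edges F) W" "S \<subseteq> W" "W \<subseteq> verts F"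
    "card W \<le> Suc (steiner_distance F S)"
proof -
  obtain T where T: "subgraph T F" "connected_graph T" "S \<subseteq> verts T"
    "card (edges T) = steiner_distance F S"
    using assms by (rule steiner_distance_attained)
  then have "connected_set (edges F) (verts T)"
    by (auto simp: subgraph_def intro: simple_connected_imp_connected_set connected_set_mono)
  then show ?thesis
    using T that card_verts_le_Suc_card_edges[of T] by (auto simp: subgraph_def)
qed

lemma steiner_distance_ge_card:
  assumes "simple_graph F" "connected_graph F" "S \<subseteq> verts F"
  shows "card S - 1 \<le> steiner_distance F S"
proof -
  obtain W where W: "connected_set (edges F) W" "S \<subseteq> W" "card W \<le> Suc (steiner_distance F S)"
    using assms by (rule steiner_distance_connected_set)
  then have "card S \<le> card W" by (intro card_mono connected_set_finite)
  then show ?thesis using W by linarith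
qed

lemma finite_sdiam_set:
  assumes "finite (verts F)"
  shows "finite {steiner_distance F S |S. S \<subseteq> verts F \<and> card S = k}"
  using assms by (auto intro: finite_subset[of _ "steiner_distance F ` Pow (verts F)"])

lemma steiner_distance_le_sdiam:
  assumes "finite (verts F)" "S \<subseteq> verts F" "card S = k"
  shows "steiner_distance F S \<le> sdiam k F"
  unfolding sdiam_def using assms by (intro Max_ge finite_sdiam_set) auto

lemma sdiam_attained:
  assumes "finite (verts F)" "k \<le> card (verts F)"
  obtains S where "S \<subseteq> verts F" "card S = k" "steiner_distance F S = sdiam k F"
proof -
  let ?D = "{steiner_distance F S |S. S \<subseteq> verts F \<and> card S = k}"
  obtain S where "S \<subseteq> verts F" "card S = k" using obtain_subset_with_card_n[OF assms(2)] by blast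
  then have "?D \<noteq> {}" by blast
  then have "sdiam k F \<in> ?D"
    unfolding sdiam_def using assms by (intro Max_in finite_sdiam_set)
  then show ?thesis using that by auto
qed

lemma sdiam_le:
  assumes "finite (verts F)" "k \<le> card (verts F)"
    and "\<And>S. S \<subseteq> verts F \<Longrightarrow> card S = k \<Longrightarrow> steiner_distance F S \<le> d"
  shows "sdiam k F \<le> d"
proof -
  obtain S where "S \<subseteq> verts F" "card S = k" "steiner_distance F S = sdiam k F"
    using assms(1,2) by (rule sdiam_attained)
  then show ?thesis using assms(3)[of S] by simp
qed

text \<open>Projections of \<open>k\<close> terminals may collide, so \<open>S\<close> can have
  fewer than \<open>k\<close> elements; it is first enlarged to exactly \<open>k\<close>
  vertices.\<close>

lemma sdiam_connected_set:
  assumes "simple_graph F" "connected_graph F" "S \<subseteq> verts F" "card S \<le> k" "k \<le> card (verts F)"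
  obtains W where "connected_set (edges F) W" "S \<subseteq> W" "W \<subseteq> verts F" "card W \<le> Suc (sdiam k F)"
proof -
  have fin: "finite (verts F)" using assms(1) by (simp add: simple_graph_def)
  obtain S' where S': "S \<subseteq> S'" "S' \<subseteq> verts F" "card S' = k"
    using exists_subset_between[OF assms(4,5,3) fin] by blast
  obtain W where "connected_set (edges F) W" "S' \<subseteq> W" "W \<subseteq> verts F"
    "card W \<le> Suc (steiner_distance F S')"
    using assms(1,2) S'(2) by (rule steiner_distance_connected_set)
  then show ?thesis
    using that S' steiner_distance_le_sdiam[OF fin S'(2,3)] by (meson Suc_le_mono order_trans)
qed

section \<open>Edges and connectedness of the Cartesian product\<close>

lemma verts_cartesian_product [simp]: "verts (G \<box> H) = verts G \<times> verts H"
  by (simp add: cartesian_product_def)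

lemma edge_cartesian_product_iff:
  "{(g, h), (g', h')} \<in> edges (G \<box> H) \<longleftrightarrow>
     g \<in> verts G \<and> g' \<in> verts G \<and> h \<in> verts H \<and> h' \<in> verts H \<and>
     (g = g' \<and> {h, h'} \<in> edges H \<or> h = h' \<and> {g, g'} \<in> edges G)"
  by (auto simp: cartesian_product_def doubleton_eq_iff insert_commute)

lemma edge_cartesian_productE:
  assumes "e \<in> edges (G \<box> H)"
  obtains g h h' where "e = {(g, h), (g, h')}" "g \<in> verts G" "{h, h'} \<in> edges H"
      "h \<in> verts H" "h' \<in> verts H"
  | g g' h where "e = {(g, h), (g', h)}" "h \<in> verts H" "{g, g'} \<in> edges G"
      "g \<in> verts G" "g' \<in> verts G"
  using assms by (auto simp: cartesian_product_def)

lemma simple_graph_no_loop: "simple_graph F \<Longrightarrow> {u, v} \<in> edges F \<Longrightarrow> u \<noteq> v"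
  unfolding simple_graph_def by (auto simp: doubleton_eq_iff)

lemma simple_graph_cartesian_product:
  assumes "simple_graph G" "simple_graph H"
  shows "simple_graph (G \<box> H)"
proof -
  have "\<exists>u v. e = {u, v} \<and> u \<in> verts (G \<box> H) \<and> v \<in> verts (G \<box> H) \<and> u \<noteq> v"
    if "e \<in> edges (G \<box> H)" for e
    using that
  proof (cases rule: edge_cartesian_productE)
    case (1 g h h')
    then show ?thesis using simple_graph_no_loop[OF assms(2)]
      by (intro exI[of _ "(g, h)"] exI[of _ "(g, h')"]) auto
  next
    case (2 g g' h)
    then show ?thesis using simple_graph_no_loop[OF assms(1)]
      by (intro exI[of _ "(g, h)"] exI[of _ "(g', h)"]) auto
  qed
  then have "edges (G \<box> H) \<subseteq> {{u, v} |u v. u \<in> verts (G \<box> H) \<and> v \<in> verts (G \<box> H) \<and> u \<noteq> v}"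
    by blast
  then show ?thesis using assms by (simp add: simple_graph_def)
qed

lemma connected_set_horizontal:
  assumes "connected_set (edges G) W" "W \<subseteq> verts G" "h \<in> verts H"
  shows "connected_set (edges (G \<box> H)) (W \<times> {h})"
proof -
  have "connected_set (edges (G \<box> H)) ((\<lambda>g. (g, h)) ` W)"
    using assms
    by (intro connected_set_image[OF assms(1)]) (auto simp: edge_cartesian_product_iff inj_on_def)
  moreover have "(\<lambda>g. (g, h)) ` W = W \<times> {h}" by auto
  ultimately show ?thesis by simp
qed

lemma connected_set_vertical:
  assumes "connected_set (edges H) W" "W \<subseteq> verts H" "g \<in> verts G"
  shows "connected_set (edges (G \<box> H)) ({g} \<times> W)"
proof -
  have "connected_set (edges (G \<box> H)) ((\<lambda>h. (g, h)) ` W)"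
    using assms
    by (intro connected_set_image[OF assms(1)]) (auto simp: edge_cartesian_product_iff inj_on_def)
  moreover have "(\<lambda>h. (g, h)) ` W = {g} \<times> W" by auto
  ultimately show ?thesis by simp
qed

text \<open>The copy of \<open>P\<close> at height \<open>h\<close> meets \<open>W\<close> in
  \<open>(x, h)\<close>, so at most \<open>card P - 1\<close> vertices are new. The
  \<open>Suc\<close> on the left avoids truncated subtraction when several attachments are added
  up.\<close>

lemma connected_set_attach:
  assumes W: "connected_set (edges (G \<box> H)) W" and P: "connected_set (edges G) P"
    and "P \<subseteq> verts G" "h \<in> verts H" "x \<in> P" "(x, h) \<in> W"
  shows "connected_set (edges (G \<box> H)) (W \<union> P \<times> {h})"
    and "Suc (card (W \<union> P \<times> {h})) \<le> card W + card P"
proof -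
  have Ph: "connected_set (edges (G \<box> H)) (P \<times> {h})"
    using assms by (intro connected_set_horizontal)
  show "connected_set (edges (G \<box> H)) (W \<union> P \<times> {h})"
    using W Ph assms by (intro connected_set_Un[where x = "(x, h)"]) auto
  have fin: "finite W" "finite (P \<times> {h})" using W Ph by (auto intro: connected_set_finite)
  have "(x, h) \<in> W \<inter> P \<times> {h}" using assms by simp
  then have "card (W \<inter> P \<times> {h}) \<noteq> 0" using fin by (metis card_0_eq empty_iff finite_Int)
  then show "Suc (card (W \<union> P \<times> {h})) \<le> card W + card P"
    using card_Un_Int[OF fin] by (simp add: card_cartesian_product)
qed

lemma connected_graph_cartesian_product:
  assumes "simple_graph G" "simple_graph H" "connected_graph G" "connected_graph H"
  shows "connected_graph (G \<box> H)"
proof -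
  let ?R = "{(x, y). {x, y} \<in> edges (G \<box> H)}"
  have *: "((g, h), (g', h)) \<in> ?R\<^sup>*"
    if "(g, g') \<in> {(x, y). {x, y} \<in> edges G}\<^sup>*" "h \<in> verts H" for g g' h
    using that(1)
  proof (induction rule: rtrancl_induct)
    case (step y z)
    then have "((y, h), (z, h)) \<in> ?R"
      using that(2) simple_graph_edge_subset[OF assms(1)] by (auto simp: edge_cartesian_product_iff)
    then show ?case using step.IH by (rule rtrancl_into_rtrancl[rotated])
  qed simp
  have **: "((g, h), (g, h')) \<in> ?R\<^sup>*"
    if "(h, h') \<in> {(x, y). {x, y} \<in> edges H}\<^sup>*" "g \<in> verts G" for g h h'
    using that(1)
  proof (induction rule: rtrancl_induct)
    case (step y z)
    then have "((g, y), (g, z)) \<in> ?R"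
      using that(2) simple_graph_edge_subset[OF assms(2)] by (auto simp: edge_cartesian_product_iff)
    then show ?case using step.IH by (rule rtrancl_into_rtrancl[rotated])
  qed simp
  have "((g, h), (g', h')) \<in> ?R\<^sup>*"
    if "g \<in> verts G" "h \<in> verts H" "g' \<in> verts G" "h' \<in> verts H" for g h g' h'
    using rtrancl_trans[OF *[of g g' h] **[of h h' g']] that assms(3,4)
    by (simp add: connected_graph_def)
  then show ?thesis using assms(3,4) by (auto simp: connected_graph_def)
qed

section \<open>Connecting terminals in the product from above\<close>

text \<open>The median lets the first three terminals share the cost of a single copy of
  \<open>WG\<close>, while each further terminal pays for its own. Hence the factor
  \<open>1 + (card S - 3) = card S - 2\<close>.\<close>

lemma connected_set_product:
  assumes WG: "connected_set (edges G) WG" "WG \<subseteq> verts G"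
    and WH: "connected_set (edges H) WH" "WH \<subseteq> verts H"
    and S: "S \<subseteq> WG \<times> WH" "3 \<le> card S"
  obtains W where "connected_set (edges (G \<box> H)) W" "S \<subseteq> W" "W \<subseteq> WG \<times> WH"
    "card W \<le> card WH + (card S - 2) * (card WG - 1)"
proof -
  let ?E = "edges (G \<box> H)"
  have fS: "finite S" using S(2) by (simp add: card_ge_0_finite)
  obtain Q where Q: "Q \<subseteq> S" "card Q = 3" using obtain_subset_with_card_n[OF S(2)] by blast
  then obtain p q r where Q_eq: "Q = {p, q, r}" by (auto simp: card_3_iff)
  define S' where "S' = S - Q"
  have cS': "card S' = card S - 3"
    unfolding S'_def using card_Diff_subset[OF finite_subset[OF Q(1) fS] Q(1)] Q(2) by simp
  have pqr: "fst p \<in> WG" "fst q \<in> WG" "fst r \<in> WG" "snd p \<in> WH" "snd q \<in> WH" "snd r \<in> WH"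
    using Q(1) Q_eq S(1) by auto
  obtain x A B C where spokes: "spoke (edges G) WG x (fst p) A" "spoke (edges G) WG x (fst q) B"
    "spoke (edges G) WG x (fst r) C" and cABC: "card A + card B + card C \<le> card WG + 2"
    using connected_set_median[OF WG(1) pqr(1-3)] by blast
  have ABC: "connected_set (edges G) A" "connected_set (edges G) B" "connected_set (edges G) C"
    "A \<subseteq> WG" "B \<subseteq> WG" "C \<subseteq> WG" "x \<in> A" "x \<in> B" "x \<in> C"
    "fst p \<in> A" "fst q \<in> B" "fst r \<in> C"
    using spokes by (auto simp: spoke_def)
  have x: "x \<in> WG" using ABC by auto
  have cWG: "card WG \<noteq> 0" using x connected_set_finite[OF WG(1)] by auto
  define W0 where "W0 = {x} \<times> WH"
  define W1 where "W1 = W0 \<union> A \<times> {snd p}"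
  define W2 where "W2 = W1 \<union> B \<times> {snd q}"
  define W3 where "W3 = W2 \<union> C \<times> {snd r}"
  have W0: "connected_set ?E W0" "card W0 = card WH" "{x} \<times> WH \<subseteq> W0"
    unfolding W0_def using x WG WH by (auto intro: connected_set_vertical simp: card_cartesian_product)
  have W1: "connected_set ?E W1" "Suc (card W1) \<le> card W0 + card A" "{x} \<times> WH \<subseteq> W1"
    using connected_set_attach[OF W0(1) ABC(1) _ _ ABC(7), of "snd p"]
      W0(3) ABC(4) WG(2) WH(2) pqr by (auto simp: W1_def)
  have W2: "connected_set ?E W2" "Suc (card W2) \<le> card W1 + card B" "{x} \<times> WH \<subseteq> W2"
    using connected_set_attach[OF W1(1) ABC(2) _ _ ABC(8), of "snd q"]
      W1(3) ABC(5) WG(2) WH(2) pqr by (auto simp: W2_def)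
  have W3: "connected_set ?E W3" "Suc (card W3) \<le> card W2 + card C" "{x} \<times> WH \<subseteq> W3"
    using connected_set_attach[OF W2(1) ABC(3) _ _ ABC(9), of "snd r"]
      W2(3) ABC(6) WG(2) WH(2) pqr by (auto simp: W3_def)
  \<comment> \<open>The three spokes add at most
    \<open>(card A - 1) + (card B - 1) + (card C - 1)\<close> vertices, which the median bound
    limits to \<open>card WG - 1\<close>.\<close>
  have W3_bound: "card W3 \<le> card WH + (card WG - 1)"
    using W0(2) W1(2) W2(2) W3(2) cABC by linarith
  have W3_sub: "{p, q, r} \<subseteq> W3" "W3 \<subseteq> WG \<times> WH"
    using ABC x pqr unfolding W3_def W2_def W1_def W0_def by (auto simp: mem_Times_iff)
  \<comment> \<open>The other terminals are added one by one. The copy of \<open>WG\<close> at the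
    height of \<open>s\<close> contains \<open>s\<close> and meets the column
    \<open>{x} \<times> WH\<close>, so it costs at most \<open>card WG - 1\<close> new
    vertices.\<close>
  have "\<exists>W. connected_set ?E W \<and> W3 \<subseteq> W \<and> R \<subseteq> W \<and> W \<subseteq> WG \<times> WH
      \<and> card W \<le> card W3 + card R * (card WG - 1)"
    if "finite R" "R \<subseteq> S" for R
    using that
  proof (induction rule: finite_induct)
    case empty
    show ?case using W3(1) W3_sub by (intro exI[of _ W3]) auto
  next
    case (insert s R)
    then obtain W where W: "connected_set ?E W" "W3 \<subseteq> W" "R \<subseteq> W" "W \<subseteq> WG \<times> WH"
      "card W \<le> card W3 + card R * (card WG - 1)" by auto
    have s: "fst s \<in> WG" "snd s \<in> WH" using insert.prems S(1) by auto
    have h: "snd s \<in> verts H" "(x, snd s) \<in> W" using s WH W3(3) W(2) by auto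
    note att = connected_set_attach[OF W(1) WG h(1) x h(2)]
    have "card (W \<union> WG \<times> {snd s}) \<le> card W3 + card (insert s R) * (card WG - 1)"
      using att(2) W(5) insert.hyps cWG by simp
    then show ?case
      using att(1) W s by (intro exI[of _ "W \<union> WG \<times> {snd s}"]) (auto simp: mem_Times_iff)
  qed
  from this[of S'] obtain W where W: "connected_set ?E W" "W3 \<subseteq> W" "S' \<subseteq> W" "W \<subseteq> WG \<times> WH"
    "card W \<le> card W3 + card S' * (card WG - 1)"
    using fS by (auto simp: S'_def)
  have "card S - 2 = Suc (card S')" using cS' S(2) by simp
  then have "card W \<le> card WH + (card S - 2) * (card WG - 1)"
    using W(5) W3_bound by simp
  moreover have "S \<subseteq> W" using W(2,3) W3_sub(1) Q_eq unfolding S'_def by blast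
  ultimately show ?thesis using that W by blast
qed

lemma steiner_distance_product_le:
  assumes WG: "connected_set (edges G) WG" "WG \<subseteq> verts G"
    and WH: "connected_set (edges H) WH" "WH \<subseteq> verts H"
    and S: "S \<subseteq> WG \<times> WH" "3 \<le> card S"
  shows "steiner_distance (G \<box> H) S \<le> (card WH - 1) + (card S - 2) * (card WG - 1)"
    and "steiner_distance (G \<box> H) S \<le> (card WG - 1) + (card S - 2) * (card WH - 1)"
proof -
  have pos: "card WG \<noteq> 0" "card WH \<noteq> 0"
    using connected_set_finite[OF WG(1)] connected_set_finite[OF WH(1)]
      connected_set_nonempty[OF WG(1)] connected_set_nonempty[OF WH(1)] by auto
  obtain W where W: "connected_set (edges (G \<box> H)) W" "S \<subseteq> W" "W \<subseteq> WG \<times> WH"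
    "card W \<le> card WH + (card S - 2) * (card WG - 1)"
    using assms by (rule connected_set_product)
  have "W \<subseteq> verts (G \<box> H)" using W(3) WG(2) WH(2) by auto
  from steiner_distance_le_connected_set[OF W(1,2) this]
  show "steiner_distance (G \<box> H) S \<le> (card WH - 1) + (card S - 2) * (card WG - 1)"
    using W(4) pos by linarith
  \<comment> \<open>The second bound exchanges the roles of the factors: the construction is run in
    \<open>H \<box> G\<close> and carried back by the isomorphism \<open>prod.swap\<close>.\<close>
  have cS: "card (prod.swap ` S) = card S" by (simp add: card_image)
  have "prod.swap ` S \<subseteq> WH \<times> WG" "3 \<le> card (prod.swap ` S)" using S cS by auto
  from connected_set_product[OF WH WG this, unfolded cS]
  obtain V where V: "connected_set (edges (H \<box> G)) V" "prod.swap ` S \<subseteq> V" "V \<subseteq> WH \<times> WG"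
    "card V \<le> card WG + (card S - 2) * (card WH - 1)"
    by blast
  have "connected_set (edges (G \<box> H)) (prod.swap ` V)"
    using V(1) by (rule connected_set_image) (auto simp: edge_cartesian_product_iff)
  moreover have "S \<subseteq> prod.swap ` V" using V(2) by force
  moreover have "prod.swap ` V \<subseteq> verts (G \<box> H)" using V(3) WG(2) WH(2) by auto
  moreover have "card (prod.swap ` V) = card V" by (simp add: card_image)
  ultimately show "steiner_distance (G \<box> H) S \<le> (card WG - 1) + (card S - 2) * (card WH - 1)"
    using steiner_distance_le_connected_set[of "G \<box> H" "prod.swap ` V" S] V(4) pos by simp
qed

section \<open>Projections and the bound from below\<close>

text \<open>The \<open>f\<close>-image of an edge is a singleton exactly when \<open>f\<close> contracts that edge.\<close>

lemma steiner_distance_le_contraction: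
  assumes T: "simple_graph T" "connected_graph T" "S \<subseteq> verts T"
    and verts: "f ` verts T \<subseteq> verts F"
    and edges: "\<And>e. e \<in> edges T \<Longrightarrow> f ` e \<in> edges F \<or> (\<exists>x. f ` e = {x})"
    and F: "simple_graph F"
  shows "steiner_distance F (f ` S) \<le> card {e \<in> edges T. f ` e \<in> edges F}"
proof -
  let ?E = "{e \<in> edges T. f ` e \<in> edges F}"
  \<comment> \<open>The image graph drops contracted edges, which would become loops. Different
    edges may have the same image, so its edge count is only bounded by
    \<open>card ?E\<close>.\<close>
  let ?P = "\<lparr>verts = f ` verts T, edges = (`) f ` ?E\<rparr>"
  have "\<exists>u v. e = {u, v} \<and> u \<in> verts ?P \<and> v \<in> verts ?P \<and> u \<noteq> v" if e: "e \<in> edges ?P" for e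
  proof -
    obtain e' where e': "e' \<in> edges T" "e = f ` e'" "e \<in> edges F" using e by auto
    then obtain u v where uv: "e' = {u, v}" "u \<in> verts T" "v \<in> verts T"
      using T(1) unfolding simple_graph_def by blast
    then have "e = {f u, f v}" using e' by simp
    then show ?thesis using uv e'(3) simple_graph_no_loop[OF F] by auto
  qed
  then have "edges ?P \<subseteq> {{u, v} |u v. u \<in> verts ?P \<and> v \<in> verts ?P \<and> u \<noteq> v}" by blast
  then have "subgraph ?P F"
    using T(1) verts unfolding subgraph_def simple_graph_def by auto
  moreover have "connected_graph ?P"
  proof -
    let ?R = "{(x, y). {x, y} \<in> edges ?P}"
    have "(f u, f v) \<in> ?R\<^sup>*" if "(u, v) \<in> {(x, y). {x, y} \<in> edges T}\<^sup>*" for u v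
      using that
    proof (induction rule: rtrancl_induct)
      case (step y z)
      then have yz: "{y, z} \<in> edges T" by simp
      \<comment> \<open>A walk in \<open>T\<close> maps to a walk that stands still on contracted
        edges, so connectedness survives.\<close>
      have "f y = f z \<or> {f y, f z} \<in> edges ?P"
      proof (cases "f ` {y, z} \<in> edges F")
        case True
        then have "f ` {y, z} \<in> (`) f ` ?E" using yz by blast
        then show ?thesis by simp
      next
        case False
        then show ?thesis using edges[OF yz] by auto
      qed
      then show ?case
      proof
        assume "{f y, f z} \<in> edges ?P"
        then have "(f y, f z) \<in> ?R" by blast
        with step.IH show ?thesis by (rule rtrancl_into_rtrancl)
      qed (use step.IH in simp)
    qed simp
    then show ?thesis using T(2) unfolding connected_graph_def by auto
  qed
  moreover have "f ` S \<subseteq> verts ?P" using T(3) by auto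
  ultimately have "steiner_distance F (f ` S) \<le> card (edges ?P)" by (rule steiner_distance_le)
  also have "\<dots> \<le> card ?E"
    using simple_graph_finite_edges[OF T(1)] by (auto intro: card_image_le)
  finally show ?thesis .
qed

text \<open>Both projections are applied to one optimal subgraph \<open>T\<close>. Every product
  edge is contracted by one projection and kept by the other, so the two edge counts together do not
  exceed that of \<open>T\<close>.\<close>

lemma steiner_distance_product_ge:
  assumes G: "simple_graph G" "connected_graph G" and H: "simple_graph H" "connected_graph H"
    and S: "S \<subseteq> verts (G \<box> H)"
  shows "steiner_distance G (fst ` S) + steiner_distance H (snd ` S) \<le> steiner_distance (G \<box> H) S"
proof -
  obtain T where T: "subgraph T (G \<box> H)" "connected_graph T" "S \<subseteq> verts T"
    "card (edges T) = steiner_distance (G \<box> H) S"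
    using simple_graph_cartesian_product[OF G(1) H(1)]
      connected_graph_cartesian_product[OF G(1) H(1) G(2) H(2)] S
    by (rule steiner_distance_attained)
  have sT: "simple_graph T" and vT: "verts T \<subseteq> verts G \<times> verts H"
    and eT: "edges T \<subseteq> edges (G \<box> H)"
    using T(1) by (auto simp: subgraph_def)
  let ?EG = "{e \<in> edges T. fst ` e \<in> edges G}"
  let ?EH = "{e \<in> edges T. snd ` e \<in> edges H}"
  have type: "(\<exists>x. snd ` e = {x}) \<and> fst ` e \<in> edges G \<or> (\<exists>x. fst ` e = {x}) \<and> snd ` e \<in> edges H"
    if "e \<in> edges T" for e
    using subsetD[OF eT that] by (cases rule: edge_cartesian_productE) auto
  have "steiner_distance G (fst ` S) \<le> card ?EG"
    using sT T(2,3) vT type G(1) by (intro steiner_distance_le_contraction) auto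
  moreover have "steiner_distance H (snd ` S) \<le> card ?EH"
    using sT T(2,3) vT type H(1) by (intro steiner_distance_le_contraction) auto
  moreover have "card ?EG + card ?EH \<le> card (edges T)"
  proof -
    have fin: "finite (edges T)" using simple_graph_finite_edges[OF sT] .
    \<comment> \<open>An edge kept by both projections would have a singleton image that is an edge,
      that is, a loop.\<close>
    have no: "{x} \<notin> edges G" "{y} \<notin> edges H" for x y
      using simple_graph_no_loop[OF G(1), of x x] simple_graph_no_loop[OF H(1), of y y] by auto
    have "?EG \<inter> ?EH = {}" using type no by force
    then have "card ?EG + card ?EH = card (?EG \<union> ?EH)"
      using fin by (intro card_Un_disjoint[symmetric]) auto
    also have "\<dots> \<le> card (edges T)" using fin by (intro card_mono) auto
    finally show ?thesis .
  qed
  ultimately show ?thesis using T(4) by linarith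
qed

section \<open>Bounds for the Steiner diameter of the product\<close>

lemma exists_surjection_of_card_le:
  assumes "finite A" "B \<noteq> {}" "finite B" "card B \<le> card A"
  obtains f where "f ` A = B"
proof -
  have "\<exists>f. f ` A = B"
    using card_le_inj[OF assms(3,1,4)] inj_on_iff_surj[OF assms(2), of A] by blast
  then show ?thesis using that by blast
qed

text \<open>The graph of a surjection from \<open>B\<close> onto \<open>A\<close> has
  \<open>card B\<close> vertices and projects exactly onto \<open>A\<close> and \<open>B\<close>. It
  is padded to \<open>k\<close> vertices; \<open>full\<close> ensures that the padding is void or
  cannot enlarge the projections.\<close>

lemma sdiam_product_ge:
  assumes G: "simple_graph G" "connected_graph G" and H: "simple_graph H" "connected_graph H"
    and A: "A \<subseteq> verts G" "A \<noteq> {}" and B: "B \<subseteq> verts H"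
    and cards: "card A \<le> card B" "card B \<le> k" "k \<le> card (verts G) * card (verts H)"
    and full: "card B = k \<or> A = verts G \<and> B = verts H"
  shows "steiner_distance G A + steiner_distance H B \<le> sdiam k (G \<box> H)"
proof -
  have fin: "finite (verts G)" "finite (verts H)" using G H by (auto simp: simple_graph_def)
  then have finAB: "finite A" "finite B" using A B finite_subset by blast+
  obtain f where f: "f ` B = A"
    using exists_surjection_of_card_le[OF finAB(2) A(2) finAB(1) cards(1)] .
  define S0 where "S0 = (\<lambda>h. (f h, h)) ` B"
  have cS0: "card S0 = card B" unfolding S0_def by (intro card_image inj_onI) auto
  have proj0: "fst ` S0 = A" "snd ` S0 = B" unfolding S0_def using f by (auto simp: image_image)
  have S0: "S0 \<subseteq> verts (G \<box> H)" unfolding S0_def using f A B by auto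
  have cV: "card (verts (G \<box> H)) = card (verts G) * card (verts H)"
    by (simp add: card_cartesian_product)
  have finV: "finite (verts (G \<box> H))" using fin by simp
  obtain S where S: "S0 \<subseteq> S" "S \<subseteq> verts (G \<box> H)" "card S = k"
    using exists_subset_between[of S0 k "verts (G \<box> H)"] cS0 cV cards S0 finV by auto
  have "fst ` S = A \<and> snd ` S = B"
    using full
  proof
    assume "card B = k"
    then have "S0 = S" using S cS0 finite_subset[OF S(2) finV] by (intro card_subset_eq) auto
    then show ?thesis using proj0 by simp
  next
    assume *: "A = verts G \<and> B = verts H"
    have "fst ` S \<subseteq> verts G" "snd ` S \<subseteq> verts H" using S(2) by auto
    moreover have "fst ` S0 \<subseteq> fst ` S" "snd ` S0 \<subseteq> snd ` S" using S(1) by blast+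
    ultimately show ?thesis using * proj0 by auto
  qed
  then have "steiner_distance G A + steiner_distance H B \<le> steiner_distance (G \<box> H) S"
    using steiner_distance_product_ge[OF G H S(2)] by simp
  also have "\<dots> \<le> sdiam k (G \<box> H)" using finV S by (intro steiner_distance_le_sdiam)
  finally show ?thesis .
qed

text \<open>The parameters \<open>a\<close> and \<open>b\<close> cover all ranges of
  \<open>k\<close>: they become the Steiner diameter of a factor with at least \<open>k\<close>
  vertices, and the order minus one otherwise.\<close>

lemma sdiam_product_le:
  assumes G: "simple_graph G" and H: "simple_graph H"
    and k: "3 \<le> k" "k \<le> card (verts G) * card (verts H)"
    and WG: "\<And>A. A \<subseteq> verts G \<Longrightarrow> card A \<le> k \<Longrightarrow>
      \<exists>W. connected_set (edges G) W \<and> A \<subseteq> W \<and> W \<subseteq> verts G \<and> card W \<le> Suc a"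
    and WH: "\<And>B. B \<subseteq> verts H \<Longrightarrow> card B \<le> k \<Longrightarrow>
      \<exists>W. connected_set (edges H) W \<and> B \<subseteq> W \<and> W \<subseteq> verts H \<and> card W \<le> Suc b"
  shows "sdiam k (G \<box> H) \<le> b + (k - 2) * a" "sdiam k (G \<box> H) \<le> a + (k - 2) * b"
proof -
  have fin: "finite (verts (G \<box> H))" using G H by (simp add: simple_graph_def)
  have cV: "k \<le> card (verts (G \<box> H))" using k by (simp add: card_cartesian_product)
  have bound: "steiner_distance (G \<box> H) S \<le> b + (k - 2) * a
      \<and> steiner_distance (G \<box> H) S \<le> a + (k - 2) * b"
    if S: "S \<subseteq> verts (G \<box> H)" "card S = k" for S
  proof -
    have fS: "finite S" using S(1) fin by (rule finite_subset)
    have "fst ` S \<subseteq> verts G" "snd ` S \<subseteq> verts H" using S by auto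
    moreover have "card (fst ` S) \<le> k" "card (snd ` S) \<le> k"
      using card_image_le[OF fS] S(2) by metis+
    ultimately obtain U V where
      U: "connected_set (edges G) U" "fst ` S \<subseteq> U" "U \<subseteq> verts G" "card U - 1 \<le> a" and
      V: "connected_set (edges H) V" "snd ` S \<subseteq> V" "V \<subseteq> verts H" "card V - 1 \<le> b"
      using WG[of "fst ` S"] WH[of "snd ` S"] by (auto simp: le_diff_conv)
    have "S \<subseteq> U \<times> V" using U(2) V(2) by (auto simp: subset_iff image_iff)
    note le = steiner_distance_product_le[OF U(1,3) V(1,3) this, unfolded S(2), OF k(1)]
    have "(k - 2) * (card U - 1) \<le> (k - 2) * a" "(k - 2) * (card V - 1) \<le> (k - 2) * b"
      using U(4) V(4) by simp_all
    then show ?thesis using le U(4) V(4) by linarith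
  qed
  show "sdiam k (G \<box> H) \<le> b + (k - 2) * a"
    using sdiam_le[OF fin cV conjunct1[OF bound]] .
  show "sdiam k (G \<box> H) \<le> a + (k - 2) * b"
    using sdiam_le[OF fin cV conjunct2[OF bound]] .
qed

text \<open>The better of the two bounds multiplies the smaller number by \<open>k - 2\<close>; one
  of these copies joins the larger number to form \<open>a + b\<close>.\<close>

lemma add_mult_min:
  fixes a b d k :: nat
  assumes "3 \<le> k" "d \<le> b + (k - 2) * a" "d \<le> a + (k - 2) * b"
  shows "d \<le> a + b + (k - 3) * min a b"
proof -
  obtain j where "k = j + 3" using assms(1) le_Suc_ex by (metis add.commute)
  then show ?thesis using assms(2,3) by (cases "a \<le> b") (auto simp: min_def)
qed

section \<open>Large terminal sets and the final case distinction\<close>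

lemma sdiam_eq_of_vertex_connectivity:
  assumes F: "simple_graph F" "connected_graph F"
    and k: "card (verts F) - \<kappa> F + 1 \<le> k" "k \<le> card (verts F)"
  shows "sdiam k F = k - 1"
proof -
  have fin: "finite (verts F)" using F by (simp add: simple_graph_def)
  have "steiner_distance F S = k - 1" if S: "S \<subseteq> verts F" "card S = k" for S
  proof -
    let ?X = "verts F - S"
    have "card ?X = card (verts F) - k" using S fin by (simp add: card_Diff_subset finite_subset)
    then have "card ?X < \<kappa> F" using k by linarith
    \<comment> \<open>A deletion set that destroys connectedness is a candidate in the infimum
      defining \<open>\<kappa>\<close>, so the smaller set \<open>?X\<close> cannot be one.\<close>
    moreover have "\<kappa> F \<le> card ?X" if "\<not> connected_graph (delete_verts F ?X)"
      unfolding vertex_connectivity_def using that by (intro cInf_lower) auto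
    ultimately have con: "connected_graph (delete_verts F ?X)" by linarith
    have vD: "verts (delete_verts F ?X) = S" using S by (auto simp: delete_verts_def)
    have eD: "edges (delete_verts F ?X) \<subseteq> edges F" by (auto simp: delete_verts_def)
    have "connected_set (edges (delete_verts F ?X)) (verts (delete_verts F ?X))"
      using simple_graph_edge_subset[OF F(1)] con fin
      by (intro connected_graph_imp_connected_set) (auto simp: delete_verts_def)
    then have "connected_set (edges F) S" using vD eD connected_set_mono by metis
    then have "steiner_distance F S \<le> k - 1"
      using steiner_distance_le_connected_set[of F S S] S by simp
    then show ?thesis using steiner_distance_ge_card[OF F S(1)] S(2) by simp
  qed
  then show ?thesis using sdiam_attained[OF fin k(2)] by metis
qed

theorem theorem2p2:
  fixes G :: "'a ugraph" and H :: "'b ugraph" and k m n :: nat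
  assumes "3 \<le> k" and "k \<le> m * n" and "n \<le> m"
    and "simple_graph G" and "connected_graph G" and "card (verts G) = n"
    and "simple_graph H" and "connected_graph H" and "card (verts H) = m"
  shows
    "(k \<le> n \<longrightarrow>
        sdiam k G + sdiam k H \<le> sdiam k (G \<box> H) \<and>
        sdiam k (G \<box> H) \<le> sdiam k G + sdiam k H + (k - 3) * min (sdiam k G) (sdiam k H)) \<and>
     (n < k \<and> k \<le> m \<longrightarrow>
        n - 1 + sdiam k H \<le> sdiam k (G \<box> H) \<and>
        sdiam k (G \<box> H) \<le> n - 1 + sdiam k H + (k - 3) * min (n - 1) (sdiam k H)) \<and>
     (m < k \<and> k \<le> m * n \<longrightarrow>
        n + m - 2 \<le> sdiam k (G \<box> H) \<and>
        sdiam k (G \<box> H) \<le> m - 1 + (k - 2) * (n - 1)) \<and>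
     (m * n - \<kappa> (G \<box> H) + 1 \<le> k \<and> k \<le> m * n \<longrightarrow>
        sdiam k (G \<box> H) = k - 1)"
proof -
  note G = assms(4,5) and H = assms(7,8) and cG = assms(6) and cH = assms(9)
  have fin: "finite (verts G)" "finite (verts H)" using G H by (auto simp: simple_graph_def)
  have ne: "verts G \<noteq> {}" "verts H \<noteq> {}" using G H by (auto simp: connected_graph_def)
  have pos: "0 < n" "0 < m" using ne fin cG cH by (auto simp: card_gt_0_iff)
  have kV: "k \<le> card (verts G) * card (verts H)" using assms(2) cG cH by (simp add: mult.commute)
  have setG: "\<exists>W. connected_set (edges G) W \<and> A \<subseteq> W \<and> W \<subseteq> verts G \<and> card W \<le> Suc (sdiam k G)"
    if "k \<le> n" "A \<subseteq> verts G" "card A \<le> k" for A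
    using sdiam_connected_set[OF G that(2,3)] that(1) cG by metis
  have setH: "\<exists>W. connected_set (edges H) W \<and> B \<subseteq> W \<and> W \<subseteq> verts H \<and> card W \<le> Suc (sdiam k H)"
    if "k \<le> m" "B \<subseteq> verts H" "card B \<le> k" for B
    using sdiam_connected_set[OF H that(2,3)] that(1) cH by metis
  \<comment> \<open>If \<open>k > n\<close>, then \<open>G\<close> has no \<open>k\<close>-subset
    and \<open>sdiam k G\<close> is a maximum over the empty set. The whole vertex set and the value
    \<open>n - 1\<close> take its place; likewise for \<open>H\<close>.\<close>
  have allG: "\<exists>W. connected_set (edges G) W \<and> A \<subseteq> W \<and> W \<subseteq> verts G \<and> card W \<le> Suc (n - 1)"
    if "A \<subseteq> verts G" for A
    using simple_connected_imp_connected_set[OF G] that cG by auto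
  have allH: "\<exists>W. connected_set (edges H) W \<and> B \<subseteq> W \<and> W \<subseteq> verts H \<and> card W \<le> Suc (m - 1)"
    if "B \<subseteq> verts H" for B
    using simple_connected_imp_connected_set[OF H] that cH by auto
  have dG: "n - 1 \<le> steiner_distance G (verts G)" and dH: "m - 1 \<le> steiner_distance H (verts H)"
    using steiner_distance_ge_card[OF G, of "verts G"] steiner_distance_ge_card[OF H, of "verts H"]
      cG cH by auto
  have "sdiam k G + sdiam k H \<le> sdiam k (G \<box> H) \<and>
      sdiam k (G \<box> H) \<le> sdiam k G + sdiam k H + (k - 3) * min (sdiam k G) (sdiam k H)"
    if k: "k \<le> n"
  proof
    obtain A where A: "A \<subseteq> verts G" "card A = k" "steiner_distance G A = sdiam k G"
      using sdiam_attained[OF fin(1)] k cG by metis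
    obtain B where B: "B \<subseteq> verts H" "card B = k" "steiner_distance H B = sdiam k H"
      using sdiam_attained[OF fin(2)] k cH assms(3) by (metis order_trans)
    have "A \<noteq> {}" using A(2) assms(1) by auto
    then show "sdiam k G + sdiam k H \<le> sdiam k (G \<box> H)"
      using sdiam_product_ge[OF G H A(1) _ B(1) _ _ kV] A B by simp
    have "k \<le> m" using k assms(3) by simp
    then show "sdiam k (G \<box> H) \<le> sdiam k G + sdiam k H + (k - 3) * min (sdiam k G) (sdiam k H)"
      using sdiam_product_le[OF G(1) H(1) assms(1) kV setG[OF k] setH] assms(1)
      by (intro add_mult_min) auto
  qed
  moreover have "n - 1 + sdiam k H \<le> sdiam k (G \<box> H) \<and>
      sdiam k (G \<box> H) \<le> n - 1 + sdiam k H + (k - 3) * min (n - 1) (sdiam k H)"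
    if k: "n < k" "k \<le> m"
  proof
    obtain B where B: "B \<subseteq> verts H" "card B = k" "steiner_distance H B = sdiam k H"
      using sdiam_attained[OF fin(2)] k cH by metis
    show "n - 1 + sdiam k H \<le> sdiam k (G \<box> H)"
      \<comment> \<open>Since \<open>n < k\<close>, the extremal \<open>k\<close>-set
        \<open>B\<close> can be mapped onto all of \<open>verts G\<close>.\<close>
      using sdiam_product_ge[OF G H subset_refl ne(1) B(1) _ _ kV] B cG k dG by simp
    show "sdiam k (G \<box> H) \<le> n - 1 + sdiam k H + (k - 3) * min (n - 1) (sdiam k H)"
      using sdiam_product_le[OF G(1) H(1) assms(1) kV allG setH[OF k(2)]] assms(1)
      by (intro add_mult_min) auto
  qed
  moreover have "n + m - 2 \<le> sdiam k (G \<box> H) \<and> sdiam k (G \<box> H) \<le> m - 1 + (k - 2) * (n - 1)"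
    if k: "m < k"
  proof
    have "steiner_distance G (verts G) + steiner_distance H (verts H) \<le> sdiam k (G \<box> H)"
      \<comment> \<open>Here \<open>card B = m < k\<close>, so the terminal set really is padded;
        both projections are already full.\<close>
      using sdiam_product_ge[OF G H subset_refl ne(1) subset_refl _ _ kV] cG cH k assms(3) by simp
    then show "n + m - 2 \<le> sdiam k (G \<box> H)" using dG dH pos by linarith
    \<comment> \<open>Since \<open>n\<close> is at most \<open>m\<close>, the bound that repeats
      copies of \<open>G\<close> is the smaller of the two.\<close>
    show "sdiam k (G \<box> H) \<le> m - 1 + (k - 2) * (n - 1)"
      using sdiam_product_le(1)[OF G(1) H(1) assms(1) kV allG allH] .
  qed
  moreover have "sdiam k (G \<box> H) = k - 1" if "m * n - \<kappa> (G \<box> H) + 1 \<le> k"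
    using sdiam_eq_of_vertex_connectivity[OF simple_graph_cartesian_product[OF G(1) H(1)]
        connected_graph_cartesian_product[OF G(1) H(1) G(2) H(2)], of k]
      that assms(2) cG cH by (simp add: card_cartesian_product mult.commute)
  ultimately show ?thesis by blast
qed

end
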